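(* Let $R$ be a GCD domain and let $(G,\beta)$ be an edge-labeled graph over $R$ with $n$ vertices $v_1,\dots,v_n$, vertex labels $m_1,\dots,m_n\in R$ and edge labels $r_e\in R$ ($e\in E$). Suppose $F_1,F_2,\dots,F_n\in\hat R_G$ are splines. If the determinant satisfies $$\lvert F_1,F_2,\dots,F_n\rvert = u\,\hat Q_G$$ for some unit $u\in R$, then the set $\{F_1,F_2,\dots,F_n\}$ forms an $R$-module basis of $\hat R_G$.
   Context: Let $G=(V,E)$ be a graph with ordered vertices $v_1,\dots,v_n$. Each vertex $v_i$ carries a label $m_i\in R$, with associated $R$-module $M_{v_i}=m_iR$; each edge $e$ carries a label $r_e\in R$, with associated $R$-module $\beta(e)=M_e=R/r_eR$. For a vertex $v$ incident to an edge $e$, the map $M_v\to M_e$ is the quotient homomorphism (inclusion $M_v\subseteq R$ followed by the quotient map $R\to R/r_eR$). The $R$-module of (extending generalized) splines is $$\hat R_G=\{(f_1,\dots,f_n)\in R^n : f_i\in m_iR \text{ for all } i,\ \text{and } f_i-f_j\in r_eR \text{ for every edge } e=v_iv_j\},$$ and its elements are called splines. For splines $F_i=(f_{i1},\dots,f_{in})$, $i=1,\dots,n$, $\lvert F_1,\dots,F_n\rvert$ denotes the determinant of the $n\times n$ matrix whose $i$-th column is $F_i$ written from bottom to top, i.e. $(f_{in},\dots,f_{i2},f_{i1})^T$. Write $(\ )$ for greatest common divisor and $[\ ]$ for least common multiple (as usual, determined up to units of $R$). A trail $P_{ji}$ from $v_j$ to $v_i$ is an ordered sequence of vertices and edges,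 consecutive ones incident, starting at $v_j$ and ending at $v_i$, in which no edge is repeated. $(P_{ji})$ denotes the gcd of the labels of the edges of $P_{ji}$, and $\{(P_{ji})\}$ denotes the set of these gcds over all trails $P_{ji}$ from $v_j$ to $v_i$. Define $$\mathcal Q^{(i)}=\Big[\,m_i,\ \{(m_j,[\{(P_{ji})\}]) : j>i\},\ \{[\{(P_{si})\}] : s<i\}\,\Big],\qquad \hat Q_G=\prod_{i=1}^n\mathcal Q^{(i)}.$$
   Formalization: The formal theorem additionally assumes that Q̂_G is nonzero (equivalently, all vertex and edge labels are nonzero); otherwise, for n ≥ 1, taking all F_i = 0 satisfies the determinant condition but {0} is not linearly independent. *)

theory Defs
  imports "Jordan_Normal_Form.VS_Connect"
begin

text \<open>
  Vertices are \<open>0, \<dots>, n - 1\<close>, so vertex \<open>i\<close> stands for \<open>v\<^sub>i\<^sub>+\<^sub>1\<close>. Edges are two-element sets of vertices,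
  labelled by \<open>r\<close>; the vertex labels are \<open>m\<close>. The class \<open>ring_gcd\<close> is that of GCD domains with
  a chosen representative in each associate class, to which gcds and lcms are normalized.
\<close>

definition simple_graph :: "nat \<Rightarrow> nat set set \<Rightarrow> bool" where
  "simple_graph n E \<longleftrightarrow> (\<forall>e\<in>E. e \<subseteq> {..<n} \<and> card e = 2)"

definition splines ::
  "nat \<Rightarrow> nat set set \<Rightarrow> (nat \<Rightarrow> 'a) \<Rightarrow> (nat set \<Rightarrow> 'a) \<Rightarrow> 'a::comm_ring_1 vec set" where
  "splines n E m r = {f \<in> carrier_vec n.
     (\<forall>i<n. m i dvd f $ i) \<and>
     (\<forall>i<n. \<forall>j<n. {i, j} \<in> E \<longrightarrow> r {i, j} dvd f $ i - f $ j)}"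

definition spline_module ::
  "nat \<Rightarrow> nat set set \<Rightarrow> (nat \<Rightarrow> 'a) \<Rightarrow> (nat set \<Rightarrow> 'a) \<Rightarrow> ('a::comm_ring_1, 'a vec) module" where
  "spline_module n E m r = (module_vec TYPE('a) n)\<lparr>carrier := splines n E m r\<rparr>"

text \<open>\<open>vectorspace.basis\<close> with the ground field replaced by a commutative ring.\<close>

definition module_basis :: "('a::comm_ring_1, 'b, 'c) module_scheme \<Rightarrow> 'b set \<Rightarrow> bool" where
  "module_basis M B \<longleftrightarrow>
     B \<subseteq> carrier M \<and>
     LinearCombinations.module.lin_indpt class_ring M B \<and>
     LinearCombinations.module.gen_set class_ring M B"

text \<open>Column \<open>c\<close> is \<open>F c\<close> written from bottom to top.\<close>

definition spline_det :: "nat \<Rightarrow> (nat \<Rightarrow> 'a vec) \<Rightarrow> 'a::comm_ring_1" where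
  "spline_det n F = det (mat n n (\<lambda>(k, c). F c $ (n - 1 - k)))"

definition is_trail :: "nat set set \<Rightarrow> nat \<Rightarrow> nat \<Rightarrow> nat list \<Rightarrow> nat set list \<Rightarrow> bool" where
  "is_trail E j i vs es \<longleftrightarrow>
     length vs = Suc (length es) \<and> hd vs = j \<and> last vs = i \<and>
     (\<forall>k<length es. es ! k \<in> E \<and> es ! k = {vs ! k, vs ! Suc k}) \<and>
     distinct es"

definition trail_gcds :: "nat set set \<Rightarrow> (nat set \<Rightarrow> 'a) \<Rightarrow> nat \<Rightarrow> nat \<Rightarrow> 'a::ring_gcd set" where
  "trail_gcds E r j i = {gcd_list (map r es) | vs es. is_trail E j i vs es}"

text \<open>
  If no trail joins two vertices, the lcm over the empty set of trails is \<open>1\<close>.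
\<close>

definition Q_vertex ::
  "nat \<Rightarrow> nat set set \<Rightarrow> (nat \<Rightarrow> 'a) \<Rightarrow> (nat set \<Rightarrow> 'a) \<Rightarrow> nat \<Rightarrow> 'a::ring_gcd" where
  "Q_vertex n E m r i = Lcm\<^sub>f\<^sub>i\<^sub>n
     ({m i} \<union> {gcd (m j) (Lcm\<^sub>f\<^sub>i\<^sub>n (trail_gcds E r j i)) | j. i < j \<and> j < n}
            \<union> {Lcm\<^sub>f\<^sub>i\<^sub>n (trail_gcds E r s i) | s. s < i})"

definition Q_graph ::
  "nat \<Rightarrow> nat set set \<Rightarrow> (nat \<Rightarrow> 'a) \<Rightarrow> (nat set \<Rightarrow> 'a) \<Rightarrow> 'a::ring_gcd" where
  "Q_graph n E m r = (\<Prod>i<n. Q_vertex n E m r i)"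

lemma module_spline_module:
  "Module.module class_ring (spline_module n E m r :: ('a::comm_ring_1, 'a vec) module)"
proof -
  interpret vec_module "TYPE('a)" n .
  have "submodule class_ring (splines n E m r) V"
  proof (rule submodule.intro)
    show "Module.module class_ring V" by (rule module_axioms)
    show "splines n E m r \<subseteq> carrier V" by (auto simp: splines_def module_vec_simps)
    show "v \<oplus>\<^bsub>V\<^esub> w \<in> splines n E m r" if "v \<in> splines n E m r" "w \<in> splines n E m r" for v w
      using that by (auto simp: splines_def module_vec_simps add_diff_add)
    show "\<zero>\<^bsub>V\<^esub> \<in> splines n E m r" by (auto simp: splines_def module_vec_simps)
    show "c \<odot>\<^bsub>V\<^esub> v \<in> splines n E m r" if "v \<in> splines n E m r" for c v
      using that by (auto simp: splines_def module_vec_simps right_diff_distrib[symmetric])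
  qed
  from submodule_is_module[OF this] show ?thesis
    by (simp add: spline_module_def)
qed

text \<open>\<open>Lcm\<^sub>f\<^sub>i\<^sub>n\<close> returns \<open>0\<close> on infinite sets; here it is only applied to finite ones.\<close>

lemma finite_trail_gcds:
  assumes "simple_graph n E"
  shows "finite (trail_gcds E r j i)"
proof -
  have E: "finite E"
    using assms by (intro finite_subset[of E "Pow {..<n}"]) (auto simp: simple_graph_def)
  have "es \<in> {es. set es \<subseteq> E \<and> length es \<le> card E}" if "is_trail E j i vs es" for vs es
  proof -
    have "set es \<subseteq> E" "distinct es"
      using that by (auto simp: is_trail_def in_set_conv_nth)
    then show ?thesis
      using card_mono[OF E, of "set es"] by (simp add: distinct_card)
  qed
  then have "trail_gcds E r j i \<subseteq>
      (\<lambda>es. gcd_list (map r es)) ` {es. set es \<subseteq> E \<and> length es \<le> card E}"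
    unfolding trail_gcds_def by blast
  then show ?thesis
    using finite_lists_length_le[OF E] finite_surj by blast
qed

text \<open>
  If \<open>Q_graph\<close> is \<open>0\<close> and \<open>n > 0\<close>, then the zero splines have determinant \<open>Q_graph\<close> without
  forming a basis. The case to be excluded is exactly that of a zero label.
\<close>

lemma Q_graph_eq_0_iff:
  fixes m :: "nat \<Rightarrow> 'a::ring_gcd"
  assumes G: "simple_graph n E"
  shows "Q_graph n E m r = 0 \<longleftrightarrow> (\<exists>i<n. m i = 0) \<or> (\<exists>e\<in>E. r e = 0)"
proof -
  have L: "Lcm\<^sub>f\<^sub>i\<^sub>n A = 0 \<longleftrightarrow> 0 \<in> A" if "finite A" for A :: "'a set"
    using that by (simp add: Lcm_fin_0_iff)
  have T: "(0 \<in> trail_gcds E r j i) \<longleftrightarrow> (\<exists>vs es. is_trail E j i vs es \<and> (\<forall>e\<in>set es. r e = 0))" for j i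
  proof -
    have g: "0 = gcd_list (map r es) \<longleftrightarrow> (\<forall>e\<in>set es. r e = 0)" for es
      by (subst eq_commute) (auto simp: Gcd_fin_0_iff)
    show ?thesis unfolding trail_gcds_def mem_Collect_eq g by blast
  qed
  have T1: "\<exists>e\<in>E. r e = 0" if z0: "0 \<in> trail_gcds E r j i" and ne: "j \<noteq> i" for j i
  proof -
    obtain vs es where t: "is_trail E j i vs es" and z: "\<forall>e\<in>set es. r e = 0"
      using z0 T[of j i] by blast
    have "es \<noteq> []" using t ne by (auto simp: is_trail_def length_Suc_conv)
    then have "es ! 0 \<in> E" "es ! 0 \<in> set es"
      using t nth_mem[of 0 es] by (auto simp: is_trail_def simp del: nth_mem)
    then show ?thesis using z by blast
  qed
  have Q: "Q_vertex n E m r i = 0 \<longleftrightarrow> m i = 0 \<or>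
      (\<exists>j. i < j \<and> j < n \<and> m j = 0 \<and> 0 \<in> trail_gcds E r j i) \<or>
      (\<exists>s<i. 0 \<in> trail_gcds E r s i)" for i
    unfolding Q_vertex_def
    by (subst L) (auto simp: L finite_trail_gcds[OF G] eq_commute[of 0])
  show ?thesis
  proof
    assume "Q_graph n E m r = 0"
    then obtain i where "i < n" "Q_vertex n E m r i = 0" by (auto simp: Q_graph_def)
    then show "(\<exists>i<n. m i = 0) \<or> (\<exists>e\<in>E. r e = 0)" using Q T1 by (metis less_irrefl)
  next
    assume "(\<exists>i<n. m i = 0) \<or> (\<exists>e\<in>E. r e = 0)"
    then have "\<exists>i<n. Q_vertex n E m r i = 0"
    proof
      assume "\<exists>e\<in>E. r e = 0"
      then obtain e where e: "e \<in> E" "r e = 0" by blast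
      then obtain a b where "e = {a, b}" "a \<noteq> b" "a < n" "b < n"
        using G unfolding simple_graph_def by (metis card_2_iff insert_subset lessThan_iff)
      then obtain s i where si: "e = {s, i}" "s < i" "i < n"
        by (metis insert_commute linorder_neqE_nat)
      then have "is_trail E s i [s, i] [e]" using e by (simp add: is_trail_def)
      then have "0 \<in> trail_gcds E r s i" using e T by fastforce
      then show ?thesis using Q si by blast
    qed (use Q in blast)
    then show "Q_graph n E m r = 0" by (auto simp: Q_graph_def)
  qed
qed

end

theory Submission
  imports Defs
begin

text \<open>
  For splines, each of the elements \<open>q\<close> whose least common multiple is \<open>Q_vertex n E m r i\<close> divides
  row \<open>i\<close> of the determinant, either as it stands or after a row \<open>s < i\<close> has been subtracted from it.
  These row operations are unitriangular, so the determinant is divisible by \<open>\<Prod>i<n. q i\<close> for every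
  choice of one element \<open>q i\<close> per vertex. Multiplication distributes over \<open>lcm\<close>, hence it is divisible
  by \<open>Q_graph n E m r\<close>. If the determinant of \<open>F\<close> is a unit times \<open>Q_graph n E m r\<close>, Cramer's rule
  expresses every spline in terms of \<open>F\<close> with coefficients in the ring.
\<close>

\<comment> \<open>Linear independence is proved below over integral domains and applied over GCD
  domains.\<close>
subclass (in ring_gcd) idom ..

section \<open>Divisibility by products of least common multiples\<close>

text \<open>Up to normalization, multiplication distributes over \<open>lcm\<close>. An empty
  \<open>A\<close> is excluded because its lcm \<open>1\<close> would demand
  \<open>b dvd d\<close>.\<close>

lemma mult_Lcm_fin_dvd:
  fixes b d :: "'a::semiring_gcd"
  assumes "finite A" "A \<noteq> {}" "\<And>x. x \<in> A \<Longrightarrow> b * x dvd d"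
  shows "b * Lcm\<^sub>f\<^sub>i\<^sub>n A dvd d"
  using assms
proof (induction rule: finite_ne_induct)
  case (singleton x)
  then show ?case
    \<comment> \<open>The lcm of \<open>{x}\<close> is \<open>normalize x\<close>, so both products
      have the same normal form.\<close>
    using normalize_dvd_iff[of "b * normalize x" d] normalize_dvd_iff[of "b * x" d] by simp
next
  case (insert x A)
  then have "lcm (b * x) (b * Lcm\<^sub>f\<^sub>i\<^sub>n A) dvd d"
    by (intro lcm_least) auto
  then show ?case
    by (simp add: lcm_mult_left)
qed

text \<open>The factor \<open>b\<close> absorbs the element \<open>x\<close> chosen at the new
  index, so that the induction hypothesis applies with \<open>b * x\<close>. Afterwards
  \<open>b\<close> times the other lcms is the factor in \<open>mult_Lcm_fin_dvd\<close>.\<close>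

lemma prod_Lcm_fin_dvd:
  fixes d :: "'a::semiring_gcd"
  assumes "finite I" "\<And>i. i \<in> I \<Longrightarrow> finite (A i)" "\<And>i. i \<in> I \<Longrightarrow> A i \<noteq> {}"
    and "\<And>q. (\<And>i. i \<in> I \<Longrightarrow> q i \<in> A i) \<Longrightarrow> b * (\<Prod>i\<in>I. q i) dvd d"
  shows "b * (\<Prod>i\<in>I. Lcm\<^sub>f\<^sub>i\<^sub>n (A i)) dvd d"
  using assms
proof (induction arbitrary: b rule: finite_induct)
  case empty
  then show ?case by simp
next
  case (insert k I)
  have "(b * (\<Prod>i\<in>I. Lcm\<^sub>f\<^sub>i\<^sub>n (A i))) * Lcm\<^sub>f\<^sub>i\<^sub>n (A k) dvd d"
  proof (rule mult_Lcm_fin_dvd)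
    fix x assume x: "x \<in> A k"
    have "(b * x) * (\<Prod>i\<in>I. Lcm\<^sub>f\<^sub>i\<^sub>n (A i)) dvd d"
    proof (rule insert.IH)
      fix q assume q: "\<And>i. i \<in> I \<Longrightarrow> q i \<in> A i"
      have "b * (\<Prod>i\<in>insert k I. (q(k := x)) i) dvd d"
        using x q by (intro insert.prems) auto
      also have "(\<Prod>i\<in>insert k I. (q(k := x)) i) = x * (\<Prod>i\<in>I. q i)"
      proof -
        have "(\<Prod>i\<in>I. (q(k := x)) i) = (\<Prod>i\<in>I. q i)"
          using insert.hyps by (intro prod.cong) auto
        then show ?thesis
          using insert.hyps by simp
      qed
      finally show "b * x * (\<Prod>i\<in>I. q i) dvd d"
        by (simp add: mult.assoc)
    qed (use insert.prems in auto)
    then show "b * (\<Prod>i\<in>I. Lcm\<^sub>f\<^sub>i\<^sub>n (A i)) * x dvd d"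
      by (simp add: ac_simps)
  qed (use insert.prems in auto)
  then show ?case
    using insert.hyps by (simp add: ac_simps)
qed

section \<open>Determinants and unitriangular row operations\<close>

text \<open>Every term of the Leibniz expansion takes one entry from each row and so collects every
  \<open>q i\<close>.\<close>

lemma prod_dvd_det:
  fixes B :: "'a::comm_ring_1 mat"
  assumes B: "B \<in> carrier_mat n n"
    and dvd: "\<And>i j. i < n \<Longrightarrow> j < n \<Longrightarrow> q i dvd B $$ (i, j)"
  shows "(\<Prod>i<n. q i) dvd det B"
proof -
  have "(\<Prod>i<n. q i) dvd (\<Prod>i = 0..<n. B $$ (i, p i))" if "p permutes {0..<n}" for p
    unfolding atLeast0LessThan
    using permutes_in_image[OF that] by (intro prod_dvd_prod dvd) auto
  then show ?thesis
    unfolding det_def'[OF B] by (intro dvd_sum dvd_mult) auto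
qed

text \<open>The matrix \<open>T\<close> below is upper triangular because the rows of the determinant are reversed.\<close>

lemma prod_dvd_spline_det:
  fixes F :: "nat \<Rightarrow> 'a::comm_ring_1 vec"
  assumes dvd: "\<And>i. i < n \<Longrightarrow> (\<forall>c<n. q i dvd F c $ i) \<or> (\<exists>s<i. \<forall>c<n. q i dvd F c $ i - F c $ s)"
  shows "(\<Prod>i<n. q i) dvd spline_det n F"
proof -
  define A where "A = mat n n (\<lambda>(k, c). F c $ (n - 1 - k))"
  \<comment> \<open>The set \<open>S\<close> treats both cases uniformly: it is empty if row
    \<open>i\<close> stays as it is, and \<open>{s}\<close> if row \<open>s\<close> is
    subtracted.\<close>
  have "\<exists>S. (S = {} \<or> (\<exists>s<i. S = {s})) \<and> (\<forall>c<n. q i dvd F c $ i - (\<Sum>s\<in>S. F c $ s))"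
    if "i < n" for i
    using dvd[OF that]
  proof
    assume "\<forall>c<n. q i dvd F c $ i"
    then show ?thesis by (intro exI[of _ "{}"]) simp
  next
    assume "\<exists>s<i. \<forall>c<n. q i dvd F c $ i - F c $ s"
    then obtain s where "s < i" "\<forall>c<n. q i dvd F c $ i - F c $ s" by blast
    then show ?thesis by (intro exI[of _ "{s}"]) simp
  qed
  then obtain S where S: "\<And>i. i < n \<Longrightarrow> S i = {} \<or> (\<exists>s<i. S i = {s})"
    and q: "\<And>i c. i < n \<Longrightarrow> c < n \<Longrightarrow> q i dvd F c $ i - (\<Sum>s\<in>S i. F c $ s)"
    by metis
  have S_sub: "S i \<subseteq> {..<i}" if "i < n" for i
    using S[OF that] by auto
  \<comment> \<open>Matrix row \<open>k\<close> belongs to vertex \<open>n - 1 - k\<close>. Besides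
    the unit diagonal, \<open>T\<close> has \<open>-1\<close> in the column of the vertex whose row
    is subtracted.\<close>
  define T where "T = mat n n (\<lambda>(k, l).
    (if k = l then 1 else 0) - (if n - 1 - l \<in> S (n - 1 - k) then 1 else 0 :: 'a))"
  have carr: "A \<in> carrier_mat n n" "T \<in> carrier_mat n n"
    by (auto simp: A_def T_def)
  have "T $$ (k, l) = 0" if "l < k" "k < n" for k l
    using that S_sub[of "n - 1 - k"] by (auto simp: T_def)
  then have "upper_triangular T"
    using carr by (auto intro!: upper_triangularI)
  then have "det T = (\<Prod>k = 0..<n. T $$ (k, k))"
    using carr by (simp add: det_upper_triangular prod_list_diag_prod)
  also have "\<dots> = 1"
  proof (rule prod.neutral, safe)
    fix k assume "k \<in> {0..<n}"
    then show "T $$ (k, k) = 1"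
      using S_sub[of "n - 1 - k"] by (auto simp: T_def)
  qed
  finally have det: "det (T * A) = spline_det n F"
    using carr by (simp add: det_mult spline_det_def A_def)
  have "(\<Prod>k<n. q (n - 1 - k)) dvd det (T * A)"
  proof (rule prod_dvd_det)
    fix k c assume kc: "k < n" "c < n"
    have "(T * A) $$ (k, c) = (\<Sum>l<n. T $$ (k, l) * A $$ (l, c))"
      using kc carr by (simp add: scalar_prod_def atLeast0LessThan)
    also have "\<dots> = (\<Sum>l<n. (if k = l then F c $ (n - 1 - l) else 0)
        - (if n - 1 - l \<in> S (n - 1 - k) then F c $ (n - 1 - l) else 0))"
      using kc by (intro sum.cong) (auto simp: T_def A_def left_diff_distrib)
    also have "\<dots> = F c $ (n - 1 - k)
        - (\<Sum>l<n. if n - 1 - l \<in> S (n - 1 - k) then F c $ (n - 1 - l) else 0)"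
      using kc by (simp add: sum_subtractf)
    \<comment> \<open>Reversing the summation passes from matrix rows \<open>l\<close> to vertices
      \<open>s\<close>.\<close>
    also have "(\<Sum>l<n. if n - 1 - l \<in> S (n - 1 - k) then F c $ (n - 1 - l) else 0)
        = (\<Sum>s<n. if s \<in> S (n - 1 - k) then F c $ s else 0)"
      using sum.nat_diff_reindex[of "\<lambda>s. if s \<in> S (n - 1 - k) then F c $ s else 0" n]
      by (simp cong: if_cong)
    also have "\<dots> = (\<Sum>s\<in>S (n - 1 - k). F c $ s)"
      using S_sub[of "n - 1 - k"] kc
      by (subst sum.inter_restrict[symmetric]) (auto intro!: sum.cong)
    finally show "q (n - 1 - k) dvd (T * A) $$ (k, c)"
      using q[of "n - 1 - k" c] kc by simp
  qed (use carr in auto)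
  then show ?thesis
    using prod.nat_diff_reindex[of q n] by (simp add: det)
qed

section \<open>Trails and divisibility of spline determinants\<close>

lemma splines_carrier: "f \<in> splines n E m r \<Longrightarrow> f \<in> carrier_vec n"
  by (simp add: splines_def)

text \<open>The difference telescopes along the trail, and each summand is divisible by the label of
  its edge. A trail without edges has gcd \<open>0\<close> and difference \<open>0\<close>.\<close>

lemma spline_trail_dvd:
  assumes G: "simple_graph n E" and f: "f \<in> splines n E m r" and t: "is_trail E j i vs es"
  shows "gcd_list (map r es) dvd f $ j - f $ i"
proof -
  from t have len: "length vs = Suc (length es)" and hd: "hd vs = j" and last: "last vs = i"
    and e: "\<forall>k<length es. es ! k \<in> E \<and> es ! k = {vs ! k, vs ! Suc k}"
    unfolding is_trail_def by blast+
  from len have "vs \<noteq> []" by auto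
  then have ends: "vs ! 0 = j" "vs ! length es = i"
    using len hd last by (simp_all add: last_conv_nth hd_conv_nth)
  have "gcd_list (map r es) dvd f $ (vs ! 0) - f $ (vs ! k)" if "k \<le> length es" for k
    using that
  proof (induction k)
    case (Suc k)
    then have k: "k < length es" by simp
    have edge: "es ! k = {vs ! k, vs ! Suc k}" and "es ! k \<in> E"
      using e k by blast+
    moreover from this have "es ! k \<subseteq> {..<n}"
      using G unfolding simple_graph_def by blast
    ultimately have "{vs ! k, vs ! Suc k} \<in> E" "vs ! k < n" "vs ! Suc k < n"
      by auto
    then have "r (es ! k) dvd f $ (vs ! k) - f $ (vs ! Suc k)"
      using f unfolding edge splines_def by blast
    moreover have "gcd_list (map r es) dvd r (es ! k)"
      using k by (intro Gcd_fin_dvd) auto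
    ultimately have "gcd_list (map r es) dvd f $ (vs ! k) - f $ (vs ! Suc k)"
      by (rule dvd_trans[rotated])
    with Suc have "gcd_list (map r es) dvd
        (f $ (vs ! 0) - f $ (vs ! k)) + (f $ (vs ! k) - f $ (vs ! Suc k))"
      by (intro dvd_add) auto
    then show ?case by simp
  qed simp
  from this[of "length es"] show ?thesis
    by (simp add: ends)
qed

lemma spline_Lcm_trail_dvd:
  assumes "simple_graph n E" "f \<in> splines n E m r"
  shows "Lcm\<^sub>f\<^sub>i\<^sub>n (trail_gcds E r j i) dvd f $ j - f $ i"
proof (rule Lcm_fin_least)
  show "g dvd f $ j - f $ i" if "g \<in> trail_gcds E r j i" for g
    using that spline_trail_dvd[OF assms] unfolding trail_gcds_def by blast
qed (rule finite_trail_gcds[OF assms(1)])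

text \<open>Stated for arbitrary splines, so that one member of a family may later be replaced by
  any other spline.\<close>

lemma Q_graph_dvd_spline_det:
  assumes G: "simple_graph n E"
    and F: "\<And>c. c < n \<Longrightarrow> F c \<in> splines n E m r"
  shows "Q_graph n E m r dvd spline_det n F"
proof -
  have "1 * (\<Prod>i<n. Q_vertex n E m r i) dvd spline_det n F"
    unfolding Q_vertex_def
  proof (rule prod_Lcm_fin_dvd)
    fix q assume q: "\<And>i. i \<in> {..<n} \<Longrightarrow> q i \<in> {m i}
      \<union> {gcd (m j) (Lcm\<^sub>f\<^sub>i\<^sub>n (trail_gcds E r j i)) | j. i < j \<and> j < n}
      \<union> {Lcm\<^sub>f\<^sub>i\<^sub>n (trail_gcds E r s i) | s. s < i}"
    have "(\<Prod>i<n. q i) dvd spline_det n F"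
    proof (rule prod_dvd_spline_det)
      fix i assume i: "i < n"
      consider "q i = m i"
        | j where "q i = gcd (m j) (Lcm\<^sub>f\<^sub>i\<^sub>n (trail_gcds E r j i))" "j < n"
        | s where "q i = Lcm\<^sub>f\<^sub>i\<^sub>n (trail_gcds E r s i)" "s < i"
        using q[of i] i by auto
      then show "(\<forall>c<n. q i dvd F c $ i) \<or> (\<exists>s<i. \<forall>c<n. q i dvd F c $ i - F c $ s)"
      proof cases
        case 1
        then show ?thesis using F i by (simp add: splines_def)
      next
        case 2
        have "q i dvd F c $ i" if c: "c < n" for c
        proof -
          have "q i dvd m j" "q i dvd Lcm\<^sub>f\<^sub>i\<^sub>n (trail_gcds E r j i)"
            unfolding 2 by simp_all
          moreover have "m j dvd F c $ j"
            using F[OF c] 2 by (simp add: splines_def)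
          ultimately have "q i dvd F c $ j - (F c $ j - F c $ i)"
            using spline_Lcm_trail_dvd[OF G F[OF c], of j i] by (meson dvd_diff dvd_trans)
          then show ?thesis by simp
        qed
        then show ?thesis by blast
      next
        \<comment> \<open>Here only the difference is divisible, so row \<open>s\<close> has to be
          subtracted; \<open>s < i\<close> keeps the operation triangular.\<close>
        case 3
        have "q i dvd F c $ i - F c $ s" if "c < n" for c
          using spline_Lcm_trail_dvd[OF G F[OF that], of s i]
          unfolding 3 by (metis dvd_minus_iff minus_diff_eq)
        with 3 show ?thesis by blast
      qed
    qed
    then show "1 * (\<Prod>i<n. q i) dvd spline_det n F" by simp
  qed auto
  then show ?thesis
    by (simp add: Q_graph_def)
qed

section \<open>Cramer's rule and linear independence\<close>

text \<open>Cramer's rule in division-free form, from \<open>A * adj_mat A = det A\<close> times the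
  identity matrix.\<close>

lemma spline_det_cramer:
  fixes F :: "nat \<Rightarrow> 'a::comm_ring_1 vec"
  assumes i: "i < n"
  shows "(\<Sum>c<n. spline_det n (F(c := f)) * F c $ i) = spline_det n F * f $ i"
proof -
  define A where "A = mat n n (\<lambda>(k, c). F c $ (n - 1 - k))"
  define b where "b = vec n (\<lambda>k. f $ (n - 1 - k))"
  have A: "A \<in> carrier_mat n n" and b: "b \<in> carrier_vec n"
    by (auto simp: A_def b_def)
  have x: "(adj_mat A *\<^sub>v b) $ c = spline_det n (F(c := f))" if c: "c < n" for c
  proof -
    define B where "B = replace_col A b c"
    have B: "B \<in> carrier_mat n n"
      using A by (auto simp: B_def replace_col_def)
    \<comment> \<open>Cofactors of column \<open>c\<close> delete that column, so replacing it does
      not change them.\<close>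
    have "cofactor B k c = cofactor A k c" if "k < n" for k
      unfolding cofactor_def using A c that
      by (intro arg_cong2[where f = "(*)"] refl arg_cong[where f = det])
        (auto simp: B_def replace_col_def mat_delete_def intro!: eq_matI)
    moreover have "B $$ (k, c) = b $ k" if "k < n" for k
      using A c that by (simp add: B_def replace_col_def)
    ultimately have "det B = (\<Sum>k<n. b $ k * cofactor A k c)"
      by (simp add: laplace_expansion_column[OF B c])
    also have "\<dots> = (adj_mat A *\<^sub>v b) $ c"
      using A b c by (simp add: adj_mat_def scalar_prod_def atLeast0LessThan mult.commute)
    also have "B = mat n n (\<lambda>(k, l). (F(c := f)) l $ (n - 1 - k))"
      using c by (auto simp: B_def replace_col_def A_def b_def intro!: eq_matI)
    finally show ?thesis
      by (simp add: spline_det_def)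
  qed
  have "A *\<^sub>v (adj_mat A *\<^sub>v b) = det A \<cdot>\<^sub>v b"
  proof -
    have "A *\<^sub>v (adj_mat A *\<^sub>v b) = (A * adj_mat A) *\<^sub>v b"
      using A b adj_mat(1)[OF A] by simp
    also have "\<dots> = det A \<cdot>\<^sub>v b"
      unfolding adj_mat(2)[OF A] using b by (intro eq_vecI) auto
    finally show ?thesis .
  qed
  then have "(A *\<^sub>v (adj_mat A *\<^sub>v b)) $ (n - 1 - i) = (det A \<cdot>\<^sub>v b) $ (n - 1 - i)"
    by simp
  moreover have "(A *\<^sub>v (adj_mat A *\<^sub>v b)) $ (n - 1 - i)
      = (\<Sum>c<n. F c $ i * (adj_mat A *\<^sub>v b) $ c)"
    using i A adj_mat(1)[OF A] by (simp add: scalar_prod_def atLeast0LessThan A_def)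
  moreover have "(det A \<cdot>\<^sub>v b) $ (n - 1 - i) = spline_det n F * f $ i"
    using i by (simp add: b_def spline_det_def A_def)
  ultimately show ?thesis
    by (simp add: x mult.commute)
qed

text \<open>Coefficients are indexed by positions rather than vectors, so the lemma also rules out
  repetitions in \<open>F\<close>.\<close>

lemma spline_det_nonzero_independent:
  fixes F :: "nat \<Rightarrow> 'a::idom vec"
  assumes det: "spline_det n F \<noteq> 0"
    and 0: "\<And>i. i < n \<Longrightarrow> (\<Sum>c<n. y c * F c $ i) = 0"
    and c: "c < n"
  shows "y c = 0"
proof -
  define A where "A = mat n n (\<lambda>(k, c). F c $ (n - 1 - k))"
  have A: "A \<in> carrier_mat n n" by (simp add: A_def)
  have "A *\<^sub>v vec n y = 0\<^sub>v n"
    using 0 by (intro eq_vecI) (auto simp: A_def scalar_prod_def atLeast0LessThan mult.commute)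
  moreover have "det A \<noteq> 0"
    using det by (simp add: spline_det_def A_def)
  ultimately have "vec n y = 0\<^sub>v n"
    using det_0_iff_vec_prod_zero[OF A] vec_carrier by blast
  then show ?thesis
    using c by (metis index_vec index_zero_vec(1))
qed

section \<open>Linear combinations in the spline module\<close>

lemma spline_module_simps:
  "carrier (spline_module n E m r) = splines n E m r"
  "x \<oplus>\<^bsub>spline_module n E m r\<^esub> y = x + y"
  "\<zero>\<^bsub>spline_module n E m r\<^esub> = 0\<^sub>v n"
  "a \<odot>\<^bsub>spline_module n E m r\<^esub> x = a \<cdot>\<^sub>v x"
  by (simp_all add: spline_module_def module_vec_simps)

lemma spline_lincomb_index:
  fixes a :: "'a::comm_ring_1 vec \<Rightarrow> 'a"
  assumes "finite A" "A \<subseteq> splines n E m r" "i < n"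
  shows "LinearCombinations.module.lincomb (spline_module n E m r) a A $ i = (\<Sum>v\<in>A. a v * v $ i)"
proof -
  interpret M: Module.module class_ring "spline_module n E m r"
    by (rule module_spline_module)
  show ?thesis
    using assms(1,2)
  proof (induction rule: finite_induct)
    case empty
    then show ?case
      using assms(3) by (simp add: M.lincomb_def spline_module_simps)
  next
    case (insert v A)
    \<comment> \<open>Membership supplies the dimension needed to read off a coordinate of the
      sum.\<close>
    have cl: "M.lincomb a A \<in> splines n E m r"
      using M.lincomb_closed[of A a] insert.prems
      by (simp add: spline_module_simps class_ring_simps)
    have "M.lincomb a (insert v A) = a v \<cdot>\<^sub>v v + M.lincomb a A"
      using M.lincomb_insert[of A a v] insert by (simp add: spline_module_simps class_ring_simps)
    then show ?case
      using insert assms(3) splines_carrier[OF cl] splines_carrier[of v n E m r] by simp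
  qed
qed

section \<open>Independence and spanning\<close>

theorem theorem1p1:
  fixes n :: nat and E :: "nat set set"
    and m :: "nat \<Rightarrow> 'a::ring_gcd" and r :: "nat set \<Rightarrow> 'a"
    and F :: "nat \<Rightarrow> 'a vec" and u :: 'a
  assumes "simple_graph n E"
    and "Q_graph n E m r \<noteq> 0"
    and "\<And>i. i < n \<Longrightarrow> F i \<in> splines n E m r"
    and "is_unit u"
    and "spline_det n F = u * Q_graph n E m r"
  shows "module_basis (spline_module n E m r) (F ` {..<n})"
proof -
  interpret M: Module.module class_ring "spline_module n E m r"
    by (rule module_spline_module)
  have det: "spline_det n F \<noteq> 0"
    using assms(2,4,5) by auto
  have sub: "F ` {..<n} \<subseteq> splines n E m r"
    using assms(3) by auto
  \<comment> \<open>The basis is a set; injectivity turns sums over it into sums over indices. If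
    \<open>F b = F c\<close>, the relation \<open>F b - F c = 0\<close> contradicts
    independence.\<close>
  have inj: "inj_on F {..<n}"
  proof (rule inj_onI, rule ccontr)
    fix b c assume bc: "b \<in> {..<n}" "c \<in> {..<n}" "F b = F c" "b \<noteq> c"
    define y :: "nat \<Rightarrow> 'a" where "y l = (if l = b then 1 else 0) - (if l = c then 1 else 0)" for l
    have "(\<Sum>l<n. y l * F l $ i) = 0" for i
    proof -
      have "(\<Sum>l<n. y l * F l $ i)
          = (\<Sum>l<n. (if l = b then F l $ i else 0) - (if l = c then F l $ i else 0))"
        by (intro sum.cong) (auto simp: y_def)
      then show ?thesis
        using bc by (simp add: sum_subtractf)
    qed
    then have "y b = 0"
      using spline_det_nonzero_independent[OF det, of y b] bc by simp
    then show False
      using bc by (simp add: y_def)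
  qed
  have "M.lin_indpt (F ` {..<n})"
  proof
    assume "M.lin_dep (F ` {..<n})"
    then obtain A a v where A: "A \<subseteq> F ` {..<n}" "finite A" "v \<in> A" "a v \<noteq> 0"
      and 0: "M.lincomb a A = 0\<^sub>v n"
      by (auto simp: M.lin_dep_def spline_module_simps class_ring_simps)
    \<comment> \<open>The relation on \<open>A\<close> is extended by zero to all of
      \<open>F\<close>.\<close>
    define y where "y c = (if F c \<in> A then a (F c) else 0)" for c
    obtain c where c: "c < n" "v = F c"
      using A by auto
    have "(\<Sum>c<n. y c * F c $ i) = 0" if "i < n" for i
    proof -
      have "(\<Sum>c<n. y c * F c $ i) = (\<Sum>w\<in>F ` {..<n}. (if w \<in> A then a w else 0) * w $ i)"
        by (simp add: sum.reindex[OF inj] y_def)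
      also have "\<dots> = (\<Sum>w\<in>A. a w * w $ i)"
        using A by (intro sum.mono_neutral_cong_right) auto
      also have "\<dots> = M.lincomb a A $ i"
        using A sub that by (intro spline_lincomb_index[symmetric]) auto
      finally show ?thesis
        using that by (simp add: 0)
    qed
    from spline_det_nonzero_independent[OF det this c(1)] show False
      using A c by (simp add: y_def)
  qed
  moreover have "f \<in> M.span (F ` {..<n})" if f: "f \<in> splines n E m r" for f
  proof -
    \<comment> \<open>The new determinant is divisible by \<open>Q_graph n E m r\<close>, an
      associate of \<open>spline_det n F\<close>. The quotients are the coefficients of
      \<open>f\<close>.\<close>
    have "spline_det n F dvd spline_det n (F(c := f))" for c
      using Q_graph_dvd_spline_det[OF assms(1), of "F(c := f)" m r] assms(3,4,5) f by simp
    then have "\<forall>c. \<exists>y. spline_det n (F(c := f)) = spline_det n F * y"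
      by (auto simp: dvd_def)
    then obtain y where y: "\<And>c. spline_det n (F(c := f)) = spline_det n F * y c"
      by metis
    \<comment> \<open>Moves the coefficients from indices to vectors.\<close>
    define a where "a w = y (the_inv_into {..<n} F w)" for w
    have "f $ i = M.lincomb a (F ` {..<n}) $ i" if i: "i < n" for i
    proof -
      have "spline_det n F * (\<Sum>c<n. y c * F c $ i) = spline_det n F * f $ i"
        using spline_det_cramer[OF i, of F f] by (simp add: y sum_distrib_left mult.assoc)
      then have "f $ i = (\<Sum>c<n. y c * F c $ i)"
        using det by simp
      also have "\<dots> = (\<Sum>w\<in>F ` {..<n}. a w * w $ i)"
        by (simp add: sum.reindex[OF inj] a_def the_inv_into_f_f[OF inj])
      also have "\<dots> = M.lincomb a (F ` {..<n}) $ i"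
        using sub i by (intro spline_lincomb_index[symmetric]) auto
      finally show ?thesis .
    qed
    moreover have "M.lincomb a (F ` {..<n}) \<in> carrier_vec n"
      using splines_carrier[of _ n E m r] M.lincomb_closed[of "F ` {..<n}" a] sub
      by (simp add: spline_module_simps class_ring_simps)
    ultimately have "f = M.lincomb a (F ` {..<n})"
      using splines_carrier[OF f] by (intro eq_vecI) auto
    then show ?thesis
      unfolding M.span_def by (auto simp: class_ring_simps)
  qed
  moreover have "M.span (F ` {..<n}) \<subseteq> splines n E m r"
    using M.span_is_subset2[of "F ` {..<n}"] sub by (simp add: spline_module_simps)
  ultimately show ?thesis
    using sub by (auto simp: module_basis_def spline_module_simps)
qed

end
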